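(* Let $A$ be a $\Bbbk$-algebra and let $\{\!\{-,-\}\!\}$ be a double bracket on $A$ associated with the right bimodule structure. Then its $(12)$-weak double Jacobiator $(12)\mathrm{wk}\{\!\{-,-,-\}\!\}:A^{\times 3}\to A^{\otimes 3}$ is a derivation in each of its entries (each with respect to some $A$-bimodule structure on $A^{\otimes 3}$). The derivation property in the third entry is: for all $a,b,c_1,c_2\in A$, $$(12)\mathrm{wk}\{\!\{a,b,c_1c_2\}\!\}=(1\otimes 1\otimes c_1)\,\big((12)\mathrm{wk}\{\!\{a,b,c_2\}\!\}\big)+\big((12)\mathrm{wk}\{\!\{a,b,c_1\}\!\}\big)\,(1\otimes 1\otimes c_2).$$
   Context: $\Bbbk$ is a field of characteristic $0$, $\otimes=\otimes_\Bbbk$, and all algebras are unital, associative, finitely generated $\Bbbk$-algebras. An element $d\in A\otimes A$ is written $d=d'\otimes d''$ (Sweedler notation, sum suppressed), and $d^\circ=d''\otimes d'$. The symmetric group $S_m$ acts on $A^{\otimes m}$ by $\tau_\sigma(a_1\otimes\cdots\otimes a_m)=a_{\sigma^{-1}(1)}\otimes\cdots\otimes a_{\sigma^{-1}(m)}$. Products in $A^{\otimes 3}$ are taken factorwise. A double bracket on $A$ associated with the right bimodule structure is a $\Bbbk$-bilinear map $\{\!\{-,-\}\!\}:A\times A\to A\otimes A$ such that for all $a,b,c\in A$: $\{\!\{a,b\}\!\}=-\{\!\{b,a\}\!\}^\circ$; $\{\!\{a,bc\}\!\}=\{\!\{a,c\}\!\}'\otimes b\{\!\{a,c\}\!\}''+\{\!\{a,b\}\!\}'\otimes\{\!\{a,b\}\!\}''c$;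 $\{\!\{bc,a\}\!\}=b\{\!\{c,a\}\!\}'\otimes\{\!\{c,a\}\!\}''+\{\!\{b,a\}\!\}'c\otimes\{\!\{b,a\}\!\}''$. Put $\{\!\{a,b_1\otimes b_2\}\!\}_L=\{\!\{a,b_1\}\!\}\otimes b_2\in A^{\otimes 3}$ (extended linearly). The double Jacobiator is $\{\!\{a,b,c\}\!\}=\{\!\{a,\{\!\{b,c\}\!\}\}\!\}_L+\tau_{(123)}\{\!\{b,\{\!\{c,a\}\!\}\}\!\}_L+\tau_{(132)}\{\!\{c,\{\!\{a,b\}\!\}\}\!\}_L$. The $(12)$-weak double Jacobiator is $(12)\mathrm{wk}\{\!\{a,b,c\}\!\}=\{\!\{a,b,c\}\!\}-\tau_{(12)}\{\!\{b,a,c\}\!\}$. A map $D:A\to M$ into an $A$-bimodule $M$ is a derivation if it is $\Bbbk$-linear and $D(c_1c_2)=c_1\cdot D(c_2)+D(c_1)\cdot c_2$. *)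

theory Defs
  imports
    Complex_Main
    "HOL-Library.Poly_Mapping"
    "HOL-Library.Numeral_Type"
    "HOL-Combinatorics.Cycles"
begin

definition fscale :: "'k::field \<Rightarrow> ('b \<Rightarrow>\<^sub>0 'k) \<Rightarrow> ('b \<Rightarrow>\<^sub>0 'k)" where
  "fscale r = Poly_Mapping.map ((*) r)"

lemma lookup_fscale [simp]:
  "Poly_Mapping.lookup (fscale r p) x = r * Poly_Mapping.lookup p x"
  by (simp add: fscale_def map.rep_eq when_def)

interpretation free: vector_space "fscale :: 'k::field \<Rightarrow> ('b \<Rightarrow>\<^sub>0 'k) \<Rightarrow> ('b \<Rightarrow>\<^sub>0 'k)"
  by unfold_locales (auto intro!: poly_mapping_eqI simp: lookup_add algebra_simps)


(* The sort {ring, monoid_mult} is that of unital associative rings; unlike ring_1 it also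
   admits the zero ring. *)
locale k_algebra = vector_space scale
  for scale :: "'k::field \<Rightarrow> 'a::{ring,monoid_mult} \<Rightarrow> 'a" +
  assumes scale_mult_left: "scale r a * b = scale r (a * b)"
    and scale_mult_right: "a * scale r b = scale r (a * b)"
begin

definition subalgebra :: "'a set \<Rightarrow> bool" where
  "subalgebra B \<longleftrightarrow> subspace B \<and> 1 \<in> B \<and> (\<forall>a\<in>B. \<forall>b\<in>B. a * b \<in> B)"

definition finitely_generated :: bool where
  "finitely_generated \<longleftrightarrow>
     (\<exists>S. finite S \<and> (\<forall>B. subalgebra B \<longrightarrow> S \<subseteq> B \<longrightarrow> B = UNIV))"

end


text \<open>
  Tensor powers of \<open>A\<close> over \<open>\<k>\<close>, with the factors indexed by a type \<open>'n\<close> (the numeral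
  types \<open>2\<close> and \<open>3\<close> below): the free vector space on the families \<open>'n \<Rightarrow> 'a\<close>, modulo the
  multilinearity relations. A tensor is a coset, so the tensor power is the set \<open>tensors\<close>
  and not a whole type. In the numeral type \<open>n\<close> the literal \<open>n\<close> is \<open>0\<close>; the indices
  \<open>1, \<dots>, n\<close> are its \<open>n\<close> distinct elements.
\<close>

definition tup2 :: "'a \<Rightarrow> 'a \<Rightarrow> 2 \<Rightarrow> 'a" where
  "tup2 a b = (\<lambda>i. if i = 1 then a else b)"

definition tup3 :: "'a \<Rightarrow> 'a \<Rightarrow> 'a \<Rightarrow> 3 \<Rightarrow> 'a" where
  "tup3 a b c = (\<lambda>i. if i = 1 then a else if i = 2 then b else c)"

type_synonym ('n, 'a, 'k) tensor = "(('n \<Rightarrow> 'a) \<Rightarrow>\<^sub>0 'k) set"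

context k_algebra
begin

definition relations :: "(('n \<Rightarrow> 'a) \<Rightarrow>\<^sub>0 'k) set" where
  "relations =
     {Poly_Mapping.single (x(i := a + b)) 1 - Poly_Mapping.single (x(i := a)) 1
        - Poly_Mapping.single (x(i := b)) 1 | x i a b. True} \<union>
     {Poly_Mapping.single (x(i := scale r a)) 1 - fscale r (Poly_Mapping.single (x(i := a)) 1)
        | x i r a. True}"

definition cls :: "(('n \<Rightarrow> 'a) \<Rightarrow>\<^sub>0 'k) \<Rightarrow> ('n, 'a, 'k) tensor" where
  "cls p = {q. q - p \<in> free.span relations}"

definition tensors :: "('n, 'a, 'k) tensor set" where
  "tensors = range cls"

definition rep :: "('n, 'a, 'k) tensor \<Rightarrow> (('n \<Rightarrow> 'a) \<Rightarrow>\<^sub>0 'k)" where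
  "rep X = (SOME p. p \<in> X)"

definition pure :: "('n \<Rightarrow> 'a) \<Rightarrow> ('n, 'a, 'k) tensor" where
  "pure x = cls (Poly_Mapping.single x 1)"

definition tplus :: "('n, 'a, 'k) tensor \<Rightarrow> ('n, 'a, 'k) tensor \<Rightarrow> ('n, 'a, 'k) tensor"
    (infixl "\<oplus>" 65) where
  "X \<oplus> Y = cls (rep X + rep Y)"

definition tscale :: "'k \<Rightarrow> ('n, 'a, 'k) tensor \<Rightarrow> ('n, 'a, 'k) tensor" (infixr "\<odot>" 75) where
  "r \<odot> X = cls (fscale r (rep X))"

definition tminus :: "('n, 'a, 'k) tensor \<Rightarrow> ('n, 'a, 'k) tensor \<Rightarrow> ('n, 'a, 'k) tensor"
    (infixl "\<ominus>" 65) where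
  "X \<ominus> Y = cls (rep X - rep Y)"

definition tneg :: "('n, 'a, 'k) tensor \<Rightarrow> ('n, 'a, 'k) tensor" where
  "tneg X = cls (- rep X)"

definition ext ::
    "(('m \<Rightarrow> 'a) \<Rightarrow> ('n, 'a, 'k) tensor) \<Rightarrow> (('m \<Rightarrow> 'a) \<Rightarrow>\<^sub>0 'k) \<Rightarrow> (('n \<Rightarrow> 'a) \<Rightarrow>\<^sub>0 'k)" where
  "ext F p = (\<Sum>x\<in>Poly_Mapping.keys p. fscale (Poly_Mapping.lookup p x) (rep (F x)))"

(* The linear map between tensor powers that is given by F on pure tensors. It is only
   meaningful when F is multilinear, see lin_cls and lin_pure below. *)
definition lin ::
    "(('m \<Rightarrow> 'a) \<Rightarrow> ('n, 'a, 'k) tensor) \<Rightarrow> ('m, 'a, 'k) tensor \<Rightarrow> ('n, 'a, 'k) tensor" where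
  "lin F X = cls (ext F (rep X))"

definition multilinear :: "(('m \<Rightarrow> 'a) \<Rightarrow> ('n, 'a, 'k) tensor) \<Rightarrow> bool" where
  "multilinear F \<longleftrightarrow>
     (\<forall>x. F x \<in> tensors) \<and>
     (\<forall>x i a b. F (x(i := a + b)) = F (x(i := a)) \<oplus> F (x(i := b))) \<and>
     (\<forall>x i r a. F (x(i := scale r a)) = r \<odot> F (x(i := a)))"

lemma cls_eq_iff: "cls p = cls q \<longleftrightarrow> p - q \<in> free.span relations"
proof
  assume "cls p = cls q"
  moreover have "p \<in> cls p" by (simp add: cls_def free.span_zero)
  ultimately show "p - q \<in> free.span relations" by (auto simp: cls_def)
next
  assume *: "p - q \<in> free.span relations"
  have "r - p \<in> free.span relations \<longleftrightarrow> r - q \<in> free.span relations" for r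
  proof
    assume "r - p \<in> free.span relations"
    from free.span_add[OF this *] show "r - q \<in> free.span relations" by simp
  next
    assume "r - q \<in> free.span relations"
    from free.span_diff[OF this *] show "r - p \<in> free.span relations" by simp
  qed
  then show "cls p = cls q" by (auto simp: cls_def)
qed

lemma rep_cls: "rep (cls p) - p \<in> free.span relations"
proof -
  have "p \<in> cls p" by (simp add: cls_def free.span_zero)
  then have "rep (cls p) \<in> cls p" unfolding rep_def by (rule someI)
  then show ?thesis by (simp add: cls_def)
qed

lemma cls_rep: "X \<in> tensors \<Longrightarrow> cls (rep X) = X"
  by (metis cls_eq_iff rangeE rep_cls tensors_def)

lemma tplus_cls: "cls p \<oplus> cls q = cls (p + q)"
  using free.span_add[OF rep_cls[of p] rep_cls[of q]]
  by (simp add: tplus_def cls_eq_iff algebra_simps)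

lemma tminus_cls: "cls p \<ominus> cls q = cls (p - q)"
  using free.span_diff[OF rep_cls[of p] rep_cls[of q]]
  by (simp add: tminus_def cls_eq_iff algebra_simps)

lemma tscale_cls: "r \<odot> cls p = cls (fscale r p)"
  using free.span_scale[OF rep_cls[of p], of r]
  by (simp add: tscale_def cls_eq_iff free.scale_right_diff_distrib)

lemma tneg_cls: "tneg (cls p) = cls (- p)"
  using free.span_neg[OF rep_cls[of p]]
  by (simp add: tneg_def cls_eq_iff algebra_simps)

lemma ext_superset:
  assumes "finite K" "Poly_Mapping.keys p \<subseteq> K"
  shows "ext F p = (\<Sum>x\<in>K. fscale (Poly_Mapping.lookup p x) (rep (F x)))"
  unfolding ext_def using assms
  by (intro sum.mono_neutral_left) (auto simp: in_keys_iff)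

lemma ext_add: "ext F (p + q) = ext F p + ext F q"
proof -
  let ?K = "Poly_Mapping.keys p \<union> Poly_Mapping.keys q"
  have "ext F (p + q) = (\<Sum>x\<in>?K. fscale (Poly_Mapping.lookup (p + q) x) (rep (F x)))"
    by (rule ext_superset) (auto simp: keys_add)
  moreover have "ext F p = (\<Sum>x\<in>?K. fscale (Poly_Mapping.lookup p x) (rep (F x)))"
    by (rule ext_superset) auto
  moreover have "ext F q = (\<Sum>x\<in>?K. fscale (Poly_Mapping.lookup q x) (rep (F x)))"
    by (rule ext_superset) auto
  ultimately show ?thesis
    by (simp add: lookup_add free.scale_left_distrib sum.distrib)
qed

lemma ext_fscale: "ext F (fscale r p) = fscale r (ext F p)"
proof -
  have "ext F (fscale r p) =
    (\<Sum>x\<in>Poly_Mapping.keys p. fscale (Poly_Mapping.lookup (fscale r p) x) (rep (F x)))"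
    by (rule ext_superset) (auto simp: in_keys_iff)
  then show ?thesis by (simp add: ext_def free.scale_sum_right)
qed

lemma ext_single: "ext F (Poly_Mapping.single x r) = fscale r (rep (F x))"
  by (cases "r = 0") (simp_all add: ext_def)

lemma ext_diff: "ext F (p - q) = ext F p - ext F q"
  using ext_add[of F "p - q" q] by simp

lemma ext_relations:
  fixes F :: "('m \<Rightarrow> 'a) \<Rightarrow> ('n, 'a, 'k) tensor"
  assumes F: "multilinear F" and p: "p \<in> free.span relations"
  shows "ext F p \<in> free.span relations"
  using p
proof (induction rule: free.span_induct_alt)
  case base
  show ?case by (simp add: ext_def free.span_zero)
next
  case (step c p q)
  have "ext F p \<in> free.span relations"
  proof -
    have T: "cls (rep (F x)) = F x" for x
      using F by (simp add: cls_rep multilinear_def)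
    consider x i a b where "p = Poly_Mapping.single (x(i := a + b)) 1
        - Poly_Mapping.single (x(i := a)) 1 - Poly_Mapping.single (x(i := b)) 1"
      | x i r a where "p = Poly_Mapping.single (x(i := scale r a)) 1
        - fscale r (Poly_Mapping.single (x(i := a)) 1)"
      using step(1) by (auto simp: relations_def)
    then show ?thesis
    proof cases
      case 1
      have "F (x(i := a + b)) = F (x(i := a)) \<oplus> F (x(i := b))"
        using F by (simp add: multilinear_def)
      then have "cls (rep (F (x(i := a + b)))) = cls (rep (F (x(i := a))) + rep (F (x(i := b))))"
        by (metis T tplus_def)
      then show ?thesis by (simp add: 1 ext_diff ext_add ext_single cls_eq_iff algebra_simps)
    next
      case 2
      have "F (x(i := scale r a)) = r \<odot> F (x(i := a))"
        using F by (simp add: multilinear_def)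
      then have "cls (rep (F (x(i := scale r a)))) = cls (fscale r (rep (F (x(i := a)))))"
        by (metis T tscale_def)
      then show ?thesis by (simp add: 2 ext_diff ext_single ext_fscale cls_eq_iff)
    qed
  qed
  then show ?case
    by (simp add: ext_add ext_fscale free.span_add free.span_scale step)
qed

lemma lin_cls: "multilinear F \<Longrightarrow> lin F (cls p) = cls (ext F p)"
  using ext_relations[OF _ rep_cls, of F p]
  by (simp add: lin_def cls_eq_iff ext_diff)

lemma lin_pure: "multilinear F \<Longrightarrow> lin F (pure x) = F x"
  by (simp add: pure_def lin_cls ext_single cls_rep multilinear_def)

lemma lin_tplus:
  "multilinear F \<Longrightarrow> X \<in> tensors \<Longrightarrow> Y \<in> tensors \<Longrightarrow> lin F (X \<oplus> Y) = lin F X \<oplus> lin F Y"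
  by (auto simp: tensors_def lin_cls tplus_cls ext_add)

lemma lin_tscale:
  "multilinear F \<Longrightarrow> X \<in> tensors \<Longrightarrow> lin F (r \<odot> X) = r \<odot> lin F X"
  by (auto simp: tensors_def lin_cls tscale_cls ext_fscale)

lemma multilinear_pure: "multilinear (pure :: ('n \<Rightarrow> 'a) \<Rightarrow> ('n, 'a, 'k) tensor)"
proof -
  have "Poly_Mapping.single (x(i := a + b)) 1 -
      (Poly_Mapping.single (x(i := a)) 1 + Poly_Mapping.single (x(i := b)) 1) \<in> relations"
    for x :: "'n \<Rightarrow> 'a" and i a b
    unfolding relations_def diff_diff_eq[symmetric] by blast
  moreover have "Poly_Mapping.single (x(i := scale r a)) 1 -
      fscale r (Poly_Mapping.single (x(i := a)) 1) \<in> relations" for x :: "'n \<Rightarrow> 'a" and i r a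
    unfolding relations_def by blast
  ultimately show ?thesis
    by (auto simp: multilinear_def pure_def tplus_cls tscale_cls cls_eq_iff
        tensors_def intro: free.span_base)
qed

definition tmult :: "('n, 'a, 'k) tensor \<Rightarrow> ('n, 'a, 'k) tensor \<Rightarrow> ('n, 'a, 'k) tensor"
    (infixl "\<otimes>\<cdot>" 70) where
  "X \<otimes>\<cdot> Y = lin (\<lambda>x. lin (\<lambda>y. pure (\<lambda>i. x i * y i)) Y) X"

lemma tmult_pure:
  fixes x y :: "'n \<Rightarrow> 'a"
  shows "pure x \<otimes>\<cdot> pure y = pure (\<lambda>i. x i * y i)"
proof -
  have upd: "(\<lambda>i. (u(j := a)) i * v i) = (\<lambda>i. u i * v i)(j := a * v j)"
    "(\<lambda>i. v i * (u(j := a)) i) = (\<lambda>i. v i * u i)(j := v j * a)" for u v :: "'n \<Rightarrow> 'a" and j a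
    by auto
  have 1: "multilinear (\<lambda>y. pure (\<lambda>i. x i * y i))" for x :: "'n \<Rightarrow> 'a"
    using multilinear_pure[where 'n='n]
    unfolding multilinear_def upd by (simp add: distrib_left scale_mult_right)
  have 2: "multilinear (\<lambda>x. pure (\<lambda>i. x i * y i))"
    using multilinear_pure[where 'n='n]
    unfolding multilinear_def upd by (simp add: distrib_right scale_mult_left)
  show ?thesis by (simp add: tmult_def lin_pure[OF 1] lin_pure[OF 2])
qed

definition tau :: "('n \<Rightarrow> 'n) \<Rightarrow> ('n, 'a, 'k) tensor \<Rightarrow> ('n, 'a, 'k) tensor" where
  "tau \<sigma> = lin (\<lambda>x. pure (\<lambda>i. x (inv \<sigma> i)))"

lemma tau_pure:
  fixes x :: "'n \<Rightarrow> 'a"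
  assumes "bij \<sigma>"
  shows "tau \<sigma> (pure x) = pure (\<lambda>i. x (inv \<sigma> i))"
proof -
  have upd: "(\<lambda>i. (u(j := a)) (inv \<sigma> i)) = (\<lambda>i. u (inv \<sigma> i))(\<sigma> j := a)" for u :: "'n \<Rightarrow> 'a" and j a
    using assms by (auto simp: fun_eq_iff bij_is_inj bij_is_surj surj_f_inv_f)
  have "multilinear (\<lambda>x. pure (\<lambda>i. x (inv \<sigma> i)))"
    using multilinear_pure[where 'n='n] unfolding multilinear_def upd by simp
  then show ?thesis by (simp add: tau_def lin_pure)
qed

definition flip :: "(2, 'a, 'k) tensor \<Rightarrow> (2, 'a, 'k) tensor" where
  "flip = lin (\<lambda>d. pure (tup2 (d 2) (d 1)))"

text \<open>
  In the Leibniz rules the variable \<open>d\<close> ranges over the families in the tensor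
  \<open>{{-,-}} = d' \<otimes> d''\<close>, so that \<open>d 1\<close> and \<open>d 2\<close> are the Sweedler components.
\<close>

definition right_double_bracket :: "('a \<Rightarrow> 'a \<Rightarrow> (2, 'a, 'k) tensor) \<Rightarrow> bool" where
  "right_double_bracket br \<longleftrightarrow>
     (\<forall>a b. br a b \<in> tensors) \<and>
     (\<forall>a b c. br (a + b) c = br a c \<oplus> br b c) \<and>
     (\<forall>a b c. br a (b + c) = br a b \<oplus> br a c) \<and>
     (\<forall>r a b. br (scale r a) b = r \<odot> br a b) \<and>
     (\<forall>r a b. br a (scale r b) = r \<odot> br a b) \<and>
     (\<forall>a b. br a b = tneg (flip (br b a))) \<and>
     (\<forall>a b c. br a (b * c) =
        lin (\<lambda>d. pure (tup2 (d 1) (b * d 2))) (br a c) \<oplus>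
        lin (\<lambda>d. pure (tup2 (d 1) (d 2 * c))) (br a b)) \<and>
     (\<forall>a b c. br (b * c) a =
        lin (\<lambda>d. pure (tup2 (b * d 1) (d 2))) (br c a) \<oplus>
        lin (\<lambda>d. pure (tup2 (d 1 * c) (d 2))) (br b a))"

definition bracket_L ::
    "('a \<Rightarrow> 'a \<Rightarrow> (2, 'a, 'k) tensor) \<Rightarrow> 'a \<Rightarrow> (2, 'a, 'k) tensor \<Rightarrow> (3, 'a, 'k) tensor" where
  "bracket_L br a = lin (\<lambda>b. lin (\<lambda>d. pure (tup3 (d 1) (d 2) (b 2))) (br a (b 1)))"

definition double_jacobiator ::
    "('a \<Rightarrow> 'a \<Rightarrow> (2, 'a, 'k) tensor) \<Rightarrow> 'a \<Rightarrow> 'a \<Rightarrow> 'a \<Rightarrow> (3, 'a, 'k) tensor" where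
  "double_jacobiator br a b c =
     bracket_L br a (br b c)
     \<oplus> tau (cycle_of_list [1, 2, 3]) (bracket_L br b (br c a))
     \<oplus> tau (cycle_of_list [1, 3, 2]) (bracket_L br c (br a b))"

definition weak_jacobiator12 ::
    "('a \<Rightarrow> 'a \<Rightarrow> (2, 'a, 'k) tensor) \<Rightarrow> 'a \<Rightarrow> 'a \<Rightarrow> 'a \<Rightarrow> (3, 'a, 'k) tensor" where
  "weak_jacobiator12 br a b c =
     double_jacobiator br a b c \<ominus> tau (cycle_of_list [1, 2]) (double_jacobiator br b a c)"

(* Bimodules over a k-algebra are k-central: scalars of the algebra act from either side as the
   given scalar multiplication. *)
definition tensor_bimodule ::
    "('a \<Rightarrow> ('n, 'a, 'k) tensor \<Rightarrow> ('n, 'a, 'k) tensor) \<Rightarrow>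
     (('n, 'a, 'k) tensor \<Rightarrow> 'a \<Rightarrow> ('n, 'a, 'k) tensor) \<Rightarrow> bool" where
  "tensor_bimodule l r \<longleftrightarrow>
     (\<forall>a. \<forall>X\<in>tensors. l a X \<in> tensors \<and> r X a \<in> tensors) \<and>
     (\<forall>a. \<forall>X\<in>tensors. \<forall>Y\<in>tensors.
        l a (X \<oplus> Y) = l a X \<oplus> l a Y \<and> r (X \<oplus> Y) a = r X a \<oplus> r Y a) \<and>
     (\<forall>s a. \<forall>X\<in>tensors. l a (s \<odot> X) = s \<odot> l a X \<and> r (s \<odot> X) a = s \<odot> r X a) \<and>
     (\<forall>a b. \<forall>X\<in>tensors. l (a + b) X = l a X \<oplus> l b X \<and> r X (a + b) = r X a \<oplus> r X b) \<and>
     (\<forall>s a. \<forall>X\<in>tensors. l (scale s a) X = s \<odot> l a X \<and> r X (scale s a) = s \<odot> r X a) \<and>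
     (\<forall>X\<in>tensors. l 1 X = X \<and> r X 1 = X) \<and>
     (\<forall>a b. \<forall>X\<in>tensors. l (a * b) X = l a (l b X) \<and> r X (a * b) = r (r X a) b) \<and>
     (\<forall>a b. \<forall>X\<in>tensors. r (l a X) b = l a (r X b))"

definition derivation ::
    "('a \<Rightarrow> ('n, 'a, 'k) tensor \<Rightarrow> ('n, 'a, 'k) tensor) \<Rightarrow>
     (('n, 'a, 'k) tensor \<Rightarrow> 'a \<Rightarrow> ('n, 'a, 'k) tensor) \<Rightarrow>
     ('a \<Rightarrow> ('n, 'a, 'k) tensor) \<Rightarrow> bool" where
  "derivation l r D \<longleftrightarrow>
     (\<forall>a. D a \<in> tensors) \<and>
     (\<forall>a b. D (a + b) = D a \<oplus> D b) \<and>
     (\<forall>s a. D (scale s a) = s \<odot> D a) \<and>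
     (\<forall>a b. D (a * b) = l a (D b) \<oplus> r (D a) b)"

end

end

theory Submission
  imports Defs "HOL-Analysis.Cartesian_Space"
begin

text \<open>
  Under factorwise multiplication \<open>A\<^sup>\<otimes>\<^sup>n\<close> is an associative algebra. Let \<open>slot i a\<close> be the
  pure tensor with \<open>a\<close> in the \<open>i\<close>-th factor and \<open>1\<close> elsewhere, and for \<open>i \<noteq> j\<close> let \<open>emb i j\<close> be the
  algebra map \<open>A \<otimes> A \<rightarrow> A\<^sup>\<otimes>\<^sup>3\<close> that puts the two factors into the positions \<open>i\<close> and \<open>j\<close>. In this
  language the bimodule structures of the theorem are left and right multiplication by \<open>slot i\<close>,
  the Leibniz rules say that \<open>{{a,-}}\<close> is a derivation for \<open>slot 2\<close> and \<open>{{-,a}}\<close> one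
  for \<open>slot 1\<close>, and \<open>{{a, u \<otimes> v}}\<^sub>L = emb 1 2 {{a,u}} \<cdot> slot 3 v\<close>.

  Each summand of the double Jacobiator satisfies, in each variable, the Leibniz rule up to a
  defect. There is a defect only when the variable sits in the first entry of the inner bracket
  (\<open>near_derivation_inner_left\<close>): then \<open>{{b,-}}\<close> also hits the factor \<open>c\<close> or \<open>c'\<close> that the
  inner Leibniz rule has split off, which leaves the cross terms
  \<open>emb 1 2 {{b,c}} \<cdot> emb 2 3 {{c',a}} + emb 2 3 {{c,a}} \<cdot> emb 1 2 {{b,c'}}\<close>.
  After permutation of the factors, the defect of \<open>{{a,b,c}}\<close> in the third variable is
  \<open>emb 2 3 {{b,c}} \<cdot> emb 3 1 {{c',a}} + emb 3 1 {{c,a}} \<cdot> emb 2 3 {{b,c'}}\<close>, and the defects in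
  the other two variables arise from it by cyclic permutation (\<open>near_derivation_jacobiator\<close>).

  Exchange \<open>a\<close> and \<open>b\<close>, apply \<open>\<tau>\<^bsub>(12)\<^esub>\<close>, and rewrite with the skew-symmetry
  \<open>emb i j {{x,y}} = - emb j i {{y,x}}\<close>. Every defect is quadratic in the bracket, so the two signs
  cancel, and the defect is reproduced with its two summands interchanged. Hence it
  drops out of \<open>{{a,b,c}} - \<tau>\<^bsub>(12)\<^esub> {{b,a,c}}\<close>, which is therefore a derivation in each entry,
  for \<open>slot i\<close> in the \<open>i\<close>-th.
\<close>

section \<open>The vector space structure of tensors\<close>

context k_algebra
begin

lemma cls_in_tensors [simp]: "cls p \<in> tensors"
  by (simp add: tensors_def)

lemma tensorsE:
  assumes "X \<in> tensors"
  obtains p where "X = cls p"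
  using assms by (auto simp: tensors_def)

lemma in_tensors [simp]:
  "pure x \<in> tensors" "X \<oplus> Y \<in> tensors" "r \<odot> X \<in> tensors" "X \<ominus> Y \<in> tensors"
  "tneg X \<in> tensors" "lin F X \<in> tensors" "X \<otimes>\<cdot> Y \<in> tensors" "tau \<sigma> X \<in> tensors"
  by (simp_all add: pure_def tplus_def tscale_def tminus_def tneg_def lin_def tmult_def tau_def)

definition tzero :: "('n, 'a, 'k) tensor" where
  "tzero = cls 0"

lemma tzero_in_tensors [simp]: "tzero \<in> tensors"
  by (simp add: tzero_def)

lemma tplus_tzero [simp]: "X \<in> tensors \<Longrightarrow> X \<oplus> tzero = X" "X \<in> tensors \<Longrightarrow> tzero \<oplus> X = X"
  by (auto elim!: tensorsE simp: tzero_def tplus_cls)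

lemma tplus_commute: "X \<oplus> Y = Y \<oplus> X"
  by (simp add: tplus_def add.commute)

lemma tplus_assoc: "(X \<oplus> Y) \<oplus> Z = X \<oplus> (Y \<oplus> Z)"
proof -
  have "rep (cls p) + q - (p + q) \<in> free.span relations"
    and "q + rep (cls p) - (q + p) \<in> free.span relations" for p q :: "('b \<Rightarrow> 'a) \<Rightarrow>\<^sub>0 'k"
    using rep_cls[of p] by simp_all
  then have "cls (rep (cls p) + q) = cls (p + q)" "cls (q + rep (cls p)) = cls (q + p)"
    for p q :: "('b \<Rightarrow> 'a) \<Rightarrow>\<^sub>0 'k"
    by (simp_all only: cls_eq_iff)
  then show ?thesis by (simp add: tplus_def add.assoc)
qed

lemma tplus_left_commute: "X \<oplus> (Y \<oplus> Z) = Y \<oplus> (X \<oplus> Z)"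
  by (simp add: tplus_assoc[symmetric] tplus_commute[of X Y])

lemmas tplus_ac = tplus_assoc tplus_commute tplus_left_commute

lemma tscale_tplus [simp]: "r \<odot> (X \<oplus> Y) = r \<odot> X \<oplus> r \<odot> Y"
  unfolding tplus_def[of X Y] tscale_cls free.scale_right_distrib
  unfolding tplus_cls[symmetric]
  by (simp add: tscale_def)

lemma tscale_tscale: "r \<odot> s \<odot> X = (r * s) \<odot> X"
  by (simp add: tscale_def[of s] tscale_def[of "r * s"] tscale_cls)

lemma tneg_eq_tscale: "tneg X = (-1) \<odot> X"
  by (simp add: tneg_def tscale_def)

lemma tneg_tneg [simp]: "X \<in> tensors \<Longrightarrow> tneg (tneg X) = X"
  by (auto elim!: tensorsE simp: tneg_cls)

lemma tneg_tplus [simp]: "tneg (X \<oplus> Y) = tneg X \<oplus> tneg Y"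
  by (simp add: tneg_eq_tscale)

lemma tminus_eq: "X \<ominus> Y = X \<oplus> tneg Y"
proof -
  have "cls (rep X + rep (cls (- rep Y))) = cls (rep X - rep Y)"
    unfolding cls_eq_iff using rep_cls[of "- rep Y"] by simp
  then show ?thesis by (simp add: tminus_def tplus_def tneg_def)
qed

lemma tplus_tneg: "X \<oplus> tneg X = tzero"
  by (simp add: tminus_eq[symmetric] tminus_def tzero_def)

text \<open>
  Pure tensors span. Identities between linear maps of tensors are therefore reduced to pure
  tensors by this rule.
\<close>
lemma tensor_induct [consumes 1, case_names pure tplus tscale]:
  fixes X :: "('n, 'a, 'k) tensor"
  assumes X: "X \<in> tensors"
    and pure: "\<And>x. P (pure x)"
    and tplus: "\<And>X Y. X \<in> tensors \<Longrightarrow> Y \<in> tensors \<Longrightarrow> P X \<Longrightarrow> P Y \<Longrightarrow> P (X \<oplus> Y)"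
    and tscale: "\<And>r X. X \<in> tensors \<Longrightarrow> P X \<Longrightarrow> P (r \<odot> X)"
  shows "P X"
proof -
  have single: "P (cls (Poly_Mapping.single x r))" for x r
  proof -
    have "fscale r (Poly_Mapping.single x 1) = Poly_Mapping.single x r"
      by (auto intro!: poly_mapping_eqI simp: lookup_single when_def)
    then show ?thesis
      using tscale[of "pure x" r] pure[of x] by (simp add: pure_def tscale_cls)
  qed
  have "P (cls p)" for p
  proof (induction p rule: update_induct)
    case const
    show ?case using single[of _ 0] by simp
  next
    case (update f x r)
    have "Poly_Mapping.update x r f = f + Poly_Mapping.single x r"
      using update.hyps
      by (auto intro!: poly_mapping_eqI simp: lookup_update lookup_add lookup_single when_def in_keys_iff)
    then show ?case
      using tplus[OF _ _ update.IH single] by (simp add: tplus_cls)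
  qed
  with X show ?thesis by (auto elim: tensorsE)
qed

lemma pure_add: "pure (x(i := a + b)) = pure (x(i := a)) \<oplus> pure (x(i := b))"
  and pure_scale: "pure (x(i := scale r a)) = r \<odot> pure (x(i := a))"
  for x :: "'n \<Rightarrow> 'a"
  using multilinear_pure[where 'n = 'n] by (simp_all add: multilinear_def)

text \<open>
  A linear map is the linear extension of its restriction to pure tensors. This turns maps that
  are specified on Sweedler components into expressions in the tensor algebra.
\<close>
lemma lin_of_linear:
  fixes h :: "('m, 'a, 'k) tensor \<Rightarrow> ('n, 'a, 'k) tensor"
  assumes F: "\<And>x. F x = h (pure x)"
    and tensors: "\<And>X. h X \<in> tensors"
    and tplus: "\<And>X Y. X \<in> tensors \<Longrightarrow> Y \<in> tensors \<Longrightarrow> h (X \<oplus> Y) = h X \<oplus> h Y"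
    and tscale: "\<And>r X. X \<in> tensors \<Longrightarrow> h (r \<odot> X) = r \<odot> h X"
    and X: "X \<in> tensors"
  shows "lin F X = h X"
proof -
  have "multilinear F"
    by (simp add: multilinear_def F tensors tplus tscale pure_add pure_scale)
  with X show ?thesis
    by (induction X rule: tensor_induct) (simp_all add: lin_pure lin_tplus lin_tscale F tplus tscale)
qed

section \<open>The tensor power as an algebra\<close>

lemma tmult_multilinear:
  fixes x :: "'n \<Rightarrow> 'a" and Y :: "('n, 'a, 'k) tensor"
  shows "multilinear (\<lambda>y. pure (\<lambda>i. x i * y i))"
    and "Y \<in> tensors \<Longrightarrow> multilinear (\<lambda>x. lin (\<lambda>y. pure (\<lambda>i. x i * y i)) Y)"
proof -
  have upd: "(\<lambda>i. (u(j := a)) i * v i) = (\<lambda>i. u i * v i)(j := a * v j)"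
    "(\<lambda>i. v i * (u(j := a)) i) = (\<lambda>i. v i * u i)(j := v j * a)" for u v :: "'n \<Rightarrow> 'a" and j a
    by auto
  show 1: "multilinear (\<lambda>y. pure (\<lambda>i. x i * y i))" for x :: "'n \<Rightarrow> 'a"
    unfolding multilinear_def upd by (simp add: distrib_left scale_mult_right pure_add pure_scale)
  note l = lin_pure[OF 1] lin_tplus[OF 1] lin_tscale[OF 1]
  assume Y: "Y \<in> tensors"
  let ?F = "\<lambda>x. lin (\<lambda>y. pure (\<lambda>i. x i * y i)) Y"
  have "?F (x(i := a + b)) = ?F (x(i := a)) \<oplus> ?F (x(i := b))" for x i a b
    using Y
  proof (induction Y rule: tensor_induct)
    case (pure y)
    show ?case unfolding l unfolding upd by (simp add: distrib_right pure_add)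
  qed (simp_all add: l tplus_ac)
  moreover have "?F (x(i := scale r a)) = r \<odot> ?F (x(i := a))" for x i r a
    using Y
  proof (induction Y rule: tensor_induct)
    case (pure y)
    show ?case unfolding l unfolding upd by (simp add: scale_mult_left pure_scale)
  qed (simp_all add: l tscale_tscale mult.commute)
  ultimately show "multilinear ?F"
    by (simp add: multilinear_def)
qed

lemma tmult_pure_left:
  fixes x :: "'n \<Rightarrow> 'a"
  shows "Y \<in> tensors \<Longrightarrow> pure x \<otimes>\<cdot> Y = lin (\<lambda>y. pure (\<lambda>i. x i * y i)) Y"
  by (simp add: tmult_def lin_pure tmult_multilinear)

lemma tmult_tplus_left [simp]:
  "X \<in> tensors \<Longrightarrow> Y \<in> tensors \<Longrightarrow> Z \<in> tensors \<Longrightarrow> (X \<oplus> Y) \<otimes>\<cdot> Z = X \<otimes>\<cdot> Z \<oplus> Y \<otimes>\<cdot> Z"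
  by (simp add: tmult_def lin_tplus tmult_multilinear)

lemma tmult_tscale_left [simp]:
  "X \<in> tensors \<Longrightarrow> Z \<in> tensors \<Longrightarrow> (r \<odot> X) \<otimes>\<cdot> Z = r \<odot> (X \<otimes>\<cdot> Z)"
  by (simp add: tmult_def lin_tscale tmult_multilinear)

lemma tmult_tplus_right [simp]:
  assumes "X \<in> tensors" "Y \<in> tensors" "Z \<in> tensors"
  shows "X \<otimes>\<cdot> (Y \<oplus> Z) = X \<otimes>\<cdot> Y \<oplus> X \<otimes>\<cdot> Z"
  using assms(1)
  by (induction X rule: tensor_induct)
    (simp_all add: assms tmult_pure_left lin_tplus tmult_multilinear tplus_ac)

lemma tmult_tscale_right [simp]:
  assumes "X \<in> tensors" "Z \<in> tensors"
  shows "X \<otimes>\<cdot> (r \<odot> Z) = r \<odot> (X \<otimes>\<cdot> Z)"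
  using assms(1)
  by (induction X rule: tensor_induct)
    (simp_all add: assms tmult_pure_left lin_tscale tmult_multilinear tscale_tscale mult.commute)

lemma tmult_tneg [simp]:
  "X \<in> tensors \<Longrightarrow> Y \<in> tensors \<Longrightarrow> tneg X \<otimes>\<cdot> Y = tneg (X \<otimes>\<cdot> Y)"
  "X \<in> tensors \<Longrightarrow> Y \<in> tensors \<Longrightarrow> X \<otimes>\<cdot> tneg Y = tneg (X \<otimes>\<cdot> Y)"
  by (simp_all add: tneg_eq_tscale)

lemma tmult_assoc:
  assumes X: "X \<in> tensors" and Y: "Y \<in> tensors" and Z: "Z \<in> tensors"
  shows "X \<otimes>\<cdot> Y \<otimes>\<cdot> Z = X \<otimes>\<cdot> (Y \<otimes>\<cdot> Z)"
  using X
proof (induction X rule: tensor_induct)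
  case (pure x)
  show ?case using Y
  proof (induction Y rule: tensor_induct)
    case (pure y)
    show ?case using Z
      by (induction Z rule: tensor_induct) (simp_all add: tmult_pure mult.assoc)
  qed (simp_all add: Z)
qed (simp_all add: Y Z)

lemma tmult_one:
  assumes "X \<in> tensors"
  shows "pure (\<lambda>_. 1) \<otimes>\<cdot> X = X" "X \<otimes>\<cdot> pure (\<lambda>_. 1) = X"
  using assms by (induction X rule: tensor_induct) (simp_all add: tmult_pure)

section \<open>Permutation of the factors\<close>

lemma tau_multilinear:
  fixes \<sigma> :: "'n \<Rightarrow> 'n"
  assumes "bij \<sigma>"
  shows "multilinear (\<lambda>x. pure (\<lambda>i. x (inv \<sigma> i)))"
proof -
  have upd: "(\<lambda>i. (u(j := a)) (inv \<sigma> i)) = (\<lambda>i. u (inv \<sigma> i))(\<sigma> j := a)"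
    for u :: "'n \<Rightarrow> 'a" and j a
    using assms by (auto simp: fun_eq_iff bij_is_inj bij_is_surj surj_f_inv_f)
  show ?thesis
    unfolding multilinear_def upd by (simp add: pure_add pure_scale)
qed

lemma tau_linear:
  assumes "bij \<sigma>"
  shows "X \<in> tensors \<Longrightarrow> Y \<in> tensors \<Longrightarrow> tau \<sigma> (X \<oplus> Y) = tau \<sigma> X \<oplus> tau \<sigma> Y"
    and "X \<in> tensors \<Longrightarrow> tau \<sigma> (r \<odot> X) = r \<odot> tau \<sigma> X"
    and "X \<in> tensors \<Longrightarrow> tau \<sigma> (tneg X) = tneg (tau \<sigma> X)"
  by (simp_all add: tau_def tneg_eq_tscale lin_tplus lin_tscale tau_multilinear assms)

lemma tau_tzero:
  assumes "bij \<sigma>"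
  shows "tau \<sigma> tzero = tzero"
proof -
  have "tau \<sigma> tzero = tau \<sigma> (tzero \<oplus> tneg tzero)"
    by (simp only: tplus_tneg)
  also have "\<dots> = tau \<sigma> tzero \<oplus> tneg (tau \<sigma> tzero)"
    by (simp only: tau_linear assms in_tensors tzero_in_tensors)
  finally show ?thesis
    by (simp only: tplus_tneg)
qed

lemma tau_tmult:
  assumes \<sigma>: "bij \<sigma>" and X: "X \<in> tensors" and Y: "Y \<in> tensors"
  shows "tau \<sigma> (X \<otimes>\<cdot> Y) = tau \<sigma> X \<otimes>\<cdot> tau \<sigma> Y"
  using X
proof (induction X rule: tensor_induct)
  case (pure x)
  show ?case using Y
    by (induction Y rule: tensor_induct) (simp_all add: tmult_pure tau_pure tau_linear \<sigma>)
qed (simp_all add: Y tau_linear \<sigma>)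

section \<open>Insertion of algebra elements and of two-fold tensors\<close>

definition slot :: "'n \<Rightarrow> 'a \<Rightarrow> ('n, 'a, 'k) tensor" where
  "slot i a = pure ((\<lambda>_. 1)(i := a))"

lemma slot_in_tensors [simp]: "slot i a \<in> tensors"
  by (simp add: slot_def)

lemma slot_add: "slot i (a + b) = slot i a \<oplus> slot i b"
  and slot_scale: "slot i (scale r a) = r \<odot> slot i a"
  by (simp_all add: slot_def pure_add pure_scale)

lemma slot_one: "slot i 1 = pure (\<lambda>_. 1)"
  by (simp add: slot_def fun_upd_idem)

lemma slot_mult: "slot i (a * b) = slot i a \<otimes>\<cdot> slot i b"
  by (simp add: slot_def tmult_pure) (rule arg_cong[where f = pure], auto)

lemma slot_commute: "i \<noteq> j \<Longrightarrow> slot i a \<otimes>\<cdot> slot j b = slot j b \<otimes>\<cdot> slot i a"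
  by (simp add: slot_def tmult_pure) (rule arg_cong[where f = pure], auto)

lemma tau_slot:
  assumes "bij \<sigma>"
  shows "tau \<sigma> (slot i a) = slot (\<sigma> i) a"
proof -
  have "(\<lambda>j. ((\<lambda>_. 1)(i := a)) (inv \<sigma> j)) = (\<lambda>_. 1)(\<sigma> i := a)"
    using assms by (auto simp: fun_eq_iff bij_is_inj bij_is_surj surj_f_inv_f)
  then show ?thesis by (simp add: slot_def tau_pure assms)
qed

lemma tensor_bimodule_slot:
  "tensor_bimodule (\<lambda>a X. slot i a \<otimes>\<cdot> X) (\<lambda>X a. X \<otimes>\<cdot> slot i a)"
  by (simp add: tensor_bimodule_def slot_add slot_scale slot_one slot_mult tmult_one tmult_assoc)

text \<open>
  For \<open>i \<noteq> j\<close> the two slots commute, and the map below is an algebra homomorphism. It accounts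
  for all positions in which a bracket value can occur in a triple tensor, so that no Sweedler
  components have to be tracked.
\<close>
definition emb :: "'n \<Rightarrow> 'n \<Rightarrow> (2, 'a, 'k) tensor \<Rightarrow> ('n, 'a, 'k) tensor" where
  "emb i j = lin (\<lambda>d. slot i (d 1) \<otimes>\<cdot> slot j (d 2))"

text \<open>
  Instead of a family updated at an unknown index, the two arguments are varied one at a time.
\<close>
lemma multilinear2:
  fixes F :: "(2 \<Rightarrow> 'a) \<Rightarrow> ('n, 'a, 'k) tensor"
  assumes "\<And>x. F x = G (x 1) (x 2)" "\<And>a b. G a b \<in> tensors"
    "\<And>a a' b. G (a + a') b = G a b \<oplus> G a' b" "\<And>a b b'. G a (b + b') = G a b \<oplus> G a b'"
    "\<And>r a b. G (scale r a) b = r \<odot> G a b" "\<And>r a b. G a (scale r b) = r \<odot> G a b"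
  shows "multilinear F"
  unfolding multilinear_def
proof (intro conjI allI)
  fix x :: "2 \<Rightarrow> 'a" and i :: 2 and a b r
  have "i = 1 \<or> i = 2" by (rule exhaust_2)
  then show "F (x(i := a + b)) = F (x(i := a)) \<oplus> F (x(i := b))"
    "F (x(i := scale r a)) = r \<odot> F (x(i := a))"
    by (auto simp: assms)
qed (simp add: assms)

lemma emb_multilinear: "multilinear (\<lambda>d :: 2 \<Rightarrow> 'a. slot i (d 1) \<otimes>\<cdot> slot j (d 2))"
  by (rule multilinear2[where G = "\<lambda>a b. slot i a \<otimes>\<cdot> slot j b"])
    (simp_all add: slot_add slot_scale)

lemma emb_in_tensors [simp]: "emb i j X \<in> tensors"
  by (simp add: emb_def)

lemma emb_pure: "emb i j (pure x) = slot i (x 1) \<otimes>\<cdot> slot j (x 2)"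
  by (simp add: emb_def lin_pure emb_multilinear)

lemma emb_linear [simp]:
  "X \<in> tensors \<Longrightarrow> Y \<in> tensors \<Longrightarrow> emb i j (X \<oplus> Y) = emb i j X \<oplus> emb i j Y"
  "X \<in> tensors \<Longrightarrow> emb i j (r \<odot> X) = r \<odot> emb i j X"
  "X \<in> tensors \<Longrightarrow> emb i j (tneg X) = tneg (emb i j X)"
  by (simp_all add: emb_def tneg_eq_tscale lin_tplus lin_tscale emb_multilinear)

lemma emb_tmult:
  assumes "i \<noteq> j" and X: "X \<in> tensors" and Y: "Y \<in> tensors"
  shows "emb i j (X \<otimes>\<cdot> Y) = emb i j X \<otimes>\<cdot> emb i j Y"
  using X
proof (induction X rule: tensor_induct)
  case (pure x)
  show ?case using Y
  proof (induction Y rule: tensor_induct)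
    case (pure y)
    show ?case
      unfolding tmult_pure emb_pure slot_def using \<open>i \<noteq> j\<close>
      by (simp add: tmult_pure) (rule arg_cong[where f = pure], auto)
  qed simp_all
qed (simp_all add: Y)

lemma emb_slot: "emb i j (slot 1 a) = slot i a" "emb i j (slot 2 a) = slot j a"
  by (simp_all add: slot_def[where 'n = 2] emb_pure slot_one tmult_one)

lemma tup2_nth [simp]: "tup2 a b 1 = a" "tup2 a b 2 = b"
  by (simp_all add: tup2_def)

lemma pure_tup2: "pure (tup2 a b) = slot 1 a \<otimes>\<cdot> slot 2 b"
  by (simp add: slot_def tmult_pure)
    (rule arg_cong[where f = pure], use exhaust_2 in \<open>auto simp: tup2_def fun_eq_iff\<close>)

lemma pure_tup3: "pure (tup3 a b c) = slot 1 a \<otimes>\<cdot> slot 2 b \<otimes>\<cdot> slot 3 c"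
proof -
  have "tup3 a b c i =
      (if i = 1 then a else 1) * (if i = 2 then b else 1) * (if i = 3 then c else 1)" for i
    using exhaust_3[of i] by (auto simp: tup3_def)
  then have "tup3 a b c = (\<lambda>i. ((\<lambda>_. 1)(1 := a)) i * ((\<lambda>_. 1)(2 := b)) i * ((\<lambda>_. 1)(3 := c)) i)"
    by (auto simp: fun_eq_iff)
  then show ?thesis by (simp only: slot_def tmult_pure)
qed

lemma flip_in_tensors [simp]: "flip X \<in> tensors"
  by (simp add: flip_def)

lemma emb_flip:
  assumes "i \<noteq> j" and "X \<in> tensors"
  shows "emb i j (flip X) = emb j i X"
proof -
  have F: "multilinear (\<lambda>d :: 2 \<Rightarrow> 'a. pure (tup2 (d 2) (d 1)))"
    by (rule multilinear2[where G = "\<lambda>a b. pure (tup2 b a)"])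
      (simp_all add: pure_tup2 slot_add slot_scale)
  show ?thesis using assms(2)
    by (induction X rule: tensor_induct)
      (simp_all add: flip_def lin_pure lin_tplus lin_tscale F emb_pure slot_commute[OF assms(1)])
qed

lemma tau_emb:
  assumes "bij \<sigma>" and "X \<in> tensors"
  shows "tau \<sigma> (emb i j X) = emb (\<sigma> i) (\<sigma> j) X"
  using assms(2)
  by (induction X rule: tensor_induct)
    (simp_all add: tau_linear tau_tmult tau_slot emb_pure assms(1))

lemma slot_emb_commute:
  assumes "k \<noteq> i" "k \<noteq> j" and "X \<in> tensors"
  shows "slot k a \<otimes>\<cdot> emb i j X = emb i j X \<otimes>\<cdot> slot k a"
  using assms(3)
proof (induction X rule: tensor_induct)
  case (pure x)
  show ?case
    by (metis assms(1,2) emb_pure slot_commute slot_in_tensors tmult_assoc)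
qed simp_all

section \<open>Derivations up to a defect\<close>

text \<open>
  The individual summands of the Jacobiator are in general not derivations; the defect \<open>E\<close>
  records by how much they fail, so that it can be followed through sums and permutations.
\<close>
definition near_derivation ::
    "'n \<Rightarrow> ('a \<Rightarrow> 'a \<Rightarrow> ('n, 'a, 'k) tensor) \<Rightarrow> ('a \<Rightarrow> ('n, 'a, 'k) tensor) \<Rightarrow> bool" where
  "near_derivation i E D \<longleftrightarrow>
     (\<forall>a b. D a \<in> tensors \<and> E a b \<in> tensors) \<and>
     (\<forall>a b. D (a + b) = D a \<oplus> D b) \<and>
     (\<forall>s a. D (scale s a) = s \<odot> D a) \<and>
     (\<forall>a b. D (a * b) = slot i a \<otimes>\<cdot> D b \<oplus> D a \<otimes>\<cdot> slot i b \<oplus> E a b)"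

lemma near_derivation_tplus:
  assumes "near_derivation i E D" "near_derivation i E' D'"
  shows "near_derivation i (\<lambda>a b. E a b \<oplus> E' a b) (\<lambda>a. D a \<oplus> D' a)"
  using assms by (simp add: near_derivation_def tplus_ac)

lemma near_derivation_tau:
  fixes \<sigma> :: "'n \<Rightarrow> 'n"
  assumes "bij \<sigma>" "near_derivation i E D"
  shows "near_derivation (\<sigma> i) (\<lambda>a b. tau \<sigma> (E a b)) (\<lambda>a. tau \<sigma> (D a))"
  using assms by (simp add: near_derivation_def tau_linear tau_tmult tau_slot)

text \<open>
  Equal defects cancel. This is the only place where a genuine derivation is produced.
\<close>
lemma derivation_tminus:
  assumes "near_derivation i E D" "near_derivation i E' D'" "\<And>a b. E a b = E' a b"
  shows "derivation (\<lambda>a X. slot i a \<otimes>\<cdot> X) (\<lambda>X a. X \<otimes>\<cdot> slot i a) (\<lambda>a. D a \<ominus> D' a)"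
proof -
  have cancel: "X \<oplus> Y \<oplus> Z \<ominus> (X' \<oplus> Y' \<oplus> Z) = (X \<oplus> tneg X') \<oplus> (Y \<oplus> tneg Y')"
    for X Y Z X' Y' :: "('n, 'a, 'k) tensor"
  proof -
    have "X \<oplus> Y \<oplus> Z \<ominus> (X' \<oplus> Y' \<oplus> Z) = X \<oplus> tneg X' \<oplus> (Y \<oplus> tneg Y') \<oplus> (Z \<oplus> tneg Z)"
      by (simp add: tminus_eq tplus_ac)
    then show ?thesis by (simp add: tplus_tneg)
  qed
  have "D (a * b) \<ominus> D' (a * b) =
      slot i a \<otimes>\<cdot> (D b \<ominus> D' b) \<oplus> (D a \<ominus> D' a) \<otimes>\<cdot> slot i b" for a b
    using assms by (simp add: near_derivation_def cancel) (simp add: tminus_eq)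
  moreover have "D (scale s a) \<ominus> D' (scale s a) = s \<odot> (D a \<ominus> D' a)" for s a
    using assms by (simp add: near_derivation_def tminus_eq tneg_eq_tscale tscale_tscale)
  moreover have "D (a + b) \<ominus> D' (a + b) = (D a \<ominus> D' a) \<oplus> (D b \<ominus> D' b)" for a b
    using assms by (simp add: near_derivation_def tminus_eq tplus_ac)
  ultimately show ?thesis by (simp add: derivation_def)
qed

end

section \<open>Double brackets in terms of slots and embeddings\<close>

locale right_double_bracket_algebra = k_algebra scale
  for scale :: "'k::field \<Rightarrow> 'a::{ring,monoid_mult} \<Rightarrow> 'a" +
  fixes br :: "'a \<Rightarrow> 'a \<Rightarrow> (2, 'a, 'k) tensor"
  assumes right_double_bracket: "right_double_bracket br"
begin

lemma br_in_tensors [simp]: "br a b \<in> tensors"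
  and br_linear [simp]:
    "br (a + b) c = br a c \<oplus> br b c"
    "br a (b + c) = br a b \<oplus> br a c"
    "br (scale r a) b = r \<odot> br a b"
    "br a (scale r b) = r \<odot> br a b"
  and br_skew: "br a b = tneg (flip (br b a))"
  and br_mult_right_lin: "br a (b * c) =
    lin (\<lambda>d. pure (tup2 (d 1) (b * d 2))) (br a c) \<oplus>
    lin (\<lambda>d. pure (tup2 (d 1) (d 2 * c))) (br a b)"
  and br_mult_left_lin: "br (b * c) a =
    lin (\<lambda>d. pure (tup2 (b * d 1) (d 2))) (br c a) \<oplus>
    lin (\<lambda>d. pure (tup2 (d 1 * c) (d 2))) (br b a)"
proof -
  note r1 = right_double_bracket[unfolded right_double_bracket_def]
  note r2 = r1[THEN conjunct2]
  note r3 = r2[THEN conjunct2]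
  note r4 = r3[THEN conjunct2]
  note r5 = r4[THEN conjunct2]
  note r6 = r5[THEN conjunct2]
  note r7 = r6[THEN conjunct2]
  note rules = r1[THEN conjunct1] r2[THEN conjunct1] r3[THEN conjunct1] r4[THEN conjunct1]
    r5[THEN conjunct1] r6[THEN conjunct1] r7[THEN conjunct1] r7[THEN conjunct2]
  show "br a b \<in> tensors" "br (a + b) c = br a c \<oplus> br b c" "br a (b + c) = br a b \<oplus> br a c"
    "br (scale r a) b = r \<odot> br a b" "br a (scale r b) = r \<odot> br a b"
    "br a b = tneg (flip (br b a))"
    "br a (b * c) =
      lin (\<lambda>d. pure (tup2 (d 1) (b * d 2))) (br a c) \<oplus>
      lin (\<lambda>d. pure (tup2 (d 1) (d 2 * c))) (br a b)"
    "br (b * c) a =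
      lin (\<lambda>d. pure (tup2 (b * d 1) (d 2))) (br c a) \<oplus>
      lin (\<lambda>d. pure (tup2 (d 1 * c) (d 2))) (br b a)"
    by (rule rules[rule_format])+
qed

lemma br_mult_right: "br a (b * c) = slot 2 b \<otimes>\<cdot> br a c \<oplus> br a b \<otimes>\<cdot> slot 2 c"
  and br_mult_left: "br (b * c) a = slot 1 b \<otimes>\<cdot> br c a \<oplus> br b a \<otimes>\<cdot> slot 1 c"
proof -
  have "tup2 (x 1) (b * x 2) = (\<lambda>i. ((\<lambda>_. 1)(2 := b)) i * x i)"
    "tup2 (x 1) (x 2 * b) = (\<lambda>i. x i * ((\<lambda>_. 1)(2 := b)) i)"
    "tup2 (b * x 1) (x 2) = (\<lambda>i. ((\<lambda>_. 1)(1 := b)) i * x i)"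
    "tup2 (x 1 * b) (x 2) = (\<lambda>i. x i * ((\<lambda>_. 1)(1 := b)) i)" for x :: "2 \<Rightarrow> 'a" and b
    using exhaust_2 by (auto simp: tup2_def fun_eq_iff)
  then have "pure (tup2 (x 1) (b * x 2)) = slot 2 b \<otimes>\<cdot> pure x"
    "pure (tup2 (x 1) (x 2 * b)) = pure x \<otimes>\<cdot> slot 2 b"
    "pure (tup2 (b * x 1) (x 2)) = slot 1 b \<otimes>\<cdot> pure x"
    "pure (tup2 (x 1 * b) (x 2)) = pure x \<otimes>\<cdot> slot 1 b" for x :: "2 \<Rightarrow> 'a" and b
    by (simp_all only: slot_def tmult_pure)
  note pure_tup2_mult = this
  have "lin (\<lambda>d. pure (tup2 (d 1) (b * d 2))) X = slot 2 b \<otimes>\<cdot> X"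
    "lin (\<lambda>d. pure (tup2 (d 1) (d 2 * b))) X = X \<otimes>\<cdot> slot 2 b"
    "lin (\<lambda>d. pure (tup2 (b * d 1) (d 2))) X = slot 1 b \<otimes>\<cdot> X"
    "lin (\<lambda>d. pure (tup2 (d 1 * b) (d 2))) X = X \<otimes>\<cdot> slot 1 b"
    if "X \<in> tensors" for b and X :: "(2, 'a, 'k) tensor"
    by (rule lin_of_linear; simp add: pure_tup2_mult that)+
  then show "br a (b * c) = slot 2 b \<otimes>\<cdot> br a c \<oplus> br a b \<otimes>\<cdot> slot 2 c"
    "br (b * c) a = slot 1 b \<otimes>\<cdot> br c a \<oplus> br b a \<otimes>\<cdot> slot 1 c"
    by (simp_all only: br_mult_right_lin br_mult_left_lin br_in_tensors)
qed

text \<open>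
  Skew-symmetry becomes an exchange of positions. In \<open>A \<otimes> A\<close> itself it would involve \<open>flip\<close>.
\<close>
lemma emb_br_skew: "i \<noteq> j \<Longrightarrow> emb i j (br a b) = tneg (emb j i (br b a))"
  by (subst br_skew) (simp add: emb_flip)

lemma bracket_L_multilinear:
  "multilinear (\<lambda>b :: 2 \<Rightarrow> 'a. emb 1 2 (br a (b 1)) \<otimes>\<cdot> slot 3 (b 2) :: (3, 'a, 'k) tensor)"
  by (rule multilinear2[where G = "\<lambda>b c. emb 1 2 (br a b) \<otimes>\<cdot> slot 3 c"])
    (simp_all add: slot_add slot_scale)

lemma bracket_L_eq: "bracket_L br a = lin (\<lambda>b. emb 1 2 (br a (b 1)) \<otimes>\<cdot> slot 3 (b 2))"
proof -
  have "lin (\<lambda>d. pure (tup3 (d 1) (d 2) v)) X = emb 1 2 X \<otimes>\<cdot> slot 3 v" if "X \<in> tensors" for v X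
    by (rule lin_of_linear) (simp_all add: pure_tup3 emb_pure that)
  then show ?thesis by (simp add: bracket_L_def)
qed

lemma bracket_L_in_tensors [simp]: "bracket_L br a X \<in> tensors"
  by (simp add: bracket_L_eq)

lemma bracket_L_pure: "bracket_L br a (pure x) = emb 1 2 (br a (x 1)) \<otimes>\<cdot> slot 3 (x 2)"
  by (simp add: bracket_L_eq lin_pure bracket_L_multilinear)

lemma bracket_L_linear [simp]:
  "X \<in> tensors \<Longrightarrow> Y \<in> tensors \<Longrightarrow> bracket_L br a (X \<oplus> Y) = bracket_L br a X \<oplus> bracket_L br a Y"
  "X \<in> tensors \<Longrightarrow> bracket_L br a (r \<odot> X) = r \<odot> bracket_L br a X"
  by (simp_all add: bracket_L_eq lin_tplus lin_tscale bracket_L_multilinear)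

lemma bracket_L_linear_left [simp]:
  assumes "X \<in> tensors"
  shows "bracket_L br (a + b) X = bracket_L br a X \<oplus> bracket_L br b X"
    and "bracket_L br (scale r a) X = r \<odot> bracket_L br a X"
  using assms
  by (induction X rule: tensor_induct)
    (simp_all add: bracket_L_pure tplus_ac tscale_tscale mult.commute)

text \<open>
  For \<open>X = u \<otimes> v\<close> the left side is \<open>{{b, c u}} \<otimes> v\<close>. The part where the bracket hits \<open>c\<close>
  is \<open>{{b,c}}' \<otimes> {{b,c}}'' u \<otimes> v\<close>: the tensors \<open>{{b,c}}\<close> and \<open>X\<close> overlap in the second
  factor and are multiplied there. This and its mirror image below are the source of all defects.
\<close>
lemma bracket_L_slot_1_left:
  assumes "X \<in> tensors"
  shows "bracket_L br b (slot 1 c \<otimes>\<cdot> X) =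
    slot 2 c \<otimes>\<cdot> bracket_L br b X \<oplus> emb 1 2 (br b c) \<otimes>\<cdot> emb 2 3 X"
  using assms
proof (induction X rule: tensor_induct)
  case (pure x)
  have "slot 1 c \<otimes>\<cdot> pure x = pure (\<lambda>i. ((\<lambda>_. 1)(1 := c)) i * x i)"
    by (simp add: slot_def tmult_pure)
  then show ?case
    by (simp add: bracket_L_pure br_mult_right emb_tmult emb_slot emb_pure tmult_assoc)
qed (simp_all add: tplus_ac)

lemma bracket_L_slot_1_right:
  assumes "X \<in> tensors"
  shows "bracket_L br b (X \<otimes>\<cdot> slot 1 c) =
    bracket_L br b X \<otimes>\<cdot> slot 2 c \<oplus> emb 2 3 X \<otimes>\<cdot> emb 1 2 (br b c)"
  using assms
proof (induction X rule: tensor_induct)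
  case (pure x)
  have "pure x \<otimes>\<cdot> slot 1 c = pure (\<lambda>i. x i * ((\<lambda>_. 1)(1 := c)) i)"
    by (simp add: slot_def tmult_pure)
  then show ?case
    by (simp add: bracket_L_pure br_mult_right emb_tmult emb_slot emb_pure tmult_assoc
        slot_commute[of 3 2] slot_emb_commute[of 3 1 2] tplus_commute)
qed (simp_all add: tplus_ac)

text \<open>
  The second component of \<open>X\<close> is untouched by the bracket and ends up in the third factor.
\<close>
lemma bracket_L_slot_2:
  assumes "X \<in> tensors"
  shows "bracket_L br b (slot 2 c \<otimes>\<cdot> X) = slot 3 c \<otimes>\<cdot> bracket_L br b X"
    and "bracket_L br b (X \<otimes>\<cdot> slot 2 c) = bracket_L br b X \<otimes>\<cdot> slot 3 c"
proof -
  have "slot 2 c \<otimes>\<cdot> pure x = pure (\<lambda>i. ((\<lambda>_. 1)(2 := c)) i * x i)"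
    "pure x \<otimes>\<cdot> slot 2 c = pure (\<lambda>i. x i * ((\<lambda>_. 1)(2 := c)) i)" for x :: "2 \<Rightarrow> 'a"
    by (simp_all add: slot_def tmult_pure)
  note mult = this
  have "slot 3 c \<otimes>\<cdot> (emb 1 2 X \<otimes>\<cdot> Y) = emb 1 2 X \<otimes>\<cdot> (slot 3 c \<otimes>\<cdot> Y)"
    if "X \<in> tensors" "Y \<in> tensors" for X and Y :: "(3, 'a, 'k) tensor"
    using slot_emb_commute[of "3 :: 3" 1 2 X c] that by (simp add: tmult_assoc[symmetric])
  note comm = this
  show "bracket_L br b (slot 2 c \<otimes>\<cdot> X) = slot 3 c \<otimes>\<cdot> bracket_L br b X"
    using assms
    by (induction X rule: tensor_induct) (simp_all add: mult bracket_L_pure slot_mult comm)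
  show "bracket_L br b (X \<otimes>\<cdot> slot 2 c) = bracket_L br b X \<otimes>\<cdot> slot 3 c"
    using assms
    by (induction X rule: tensor_induct) (simp_all add: mult bracket_L_pure slot_mult tmult_assoc)
qed

section \<open>The defects of the double Jacobiator\<close>

text \<open>
  Each variable of the Jacobiator occurs once in every summand: as the outer argument, or in the
  second or the first entry of the inner bracket. The following three lemmas treat these cases.
\<close>
lemma near_derivation_outer:
  assumes "X \<in> tensors"
  shows "near_derivation 1 (\<lambda>_ _. tzero) (\<lambda>a. bracket_L br a X)"
proof -
  have "bracket_L br (a * b) X = slot 1 a \<otimes>\<cdot> bracket_L br b X \<oplus> bracket_L br a X \<otimes>\<cdot> slot 1 b" for a b
    using assms
  proof (induction X rule: tensor_induct)
    case (pure x)
    show ?case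
      by (simp add: bracket_L_pure br_mult_left emb_tmult emb_slot tmult_assoc slot_commute[of 1 3])
  qed (simp_all add: tplus_ac)
  then show ?thesis using assms by (simp add: near_derivation_def)
qed

lemma near_derivation_inner_right:
  "near_derivation 3 (\<lambda>_ _. tzero) (\<lambda>c. bracket_L br a (br b c))"
  by (simp add: near_derivation_def br_mult_right bracket_L_slot_2)

lemma near_derivation_inner_left:
  "near_derivation 2
     (\<lambda>c c'. emb 1 2 (br a c) \<otimes>\<cdot> emb 2 3 (br c' b) \<oplus> emb 2 3 (br c b) \<otimes>\<cdot> emb 1 2 (br a c'))
     (\<lambda>c. bracket_L br a (br c b))"
  by (simp add: near_derivation_def br_mult_left bracket_L_slot_1_left bracket_L_slot_1_right tplus_ac)

lemma cycle_123:
    "cycle_of_list [1, 2, 3] (1::3) = 2"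
    "cycle_of_list [1, 2, 3] (2::3) = 3"
    "cycle_of_list [1, 2, 3] (3::3) = 1"
  and cycle_132:
    "cycle_of_list [1, 3, 2] (1::3) = 3"
    "cycle_of_list [1, 3, 2] (2::3) = 1"
    "cycle_of_list [1, 3, 2] (3::3) = 2"
  and cycle_12:
    "cycle_of_list [1, 2] (1::3) = 2"
    "cycle_of_list [1, 2] (2::3) = 1"
    "cycle_of_list [1, 2] (3::3) = 3"
  by (simp_all add: transpose_def)

lemma bij_cycle: "bij (cycle_of_list cs)"
  by (rule permutes_bij[OF cycle_permutes])

lemmas tau_cycle = tau_linear[OF bij_cycle] tau_tmult[OF bij_cycle] tau_emb[OF bij_cycle]
  cycle_123 cycle_132 cycle_12

text \<open>
  In each variable exactly one summand has a defect, the one in which the variable comes first in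
  the inner bracket. The cyclic permutations carry the slots 1, 2 and 3, in which the
  three summands are near derivations, to one and the same slot.
\<close>
lemma near_derivation_jacobiator:
  "near_derivation 1
     (\<lambda>a a'. emb 3 1 (br c a) \<otimes>\<cdot> emb 1 2 (br a' b) \<oplus> emb 1 2 (br a b) \<otimes>\<cdot> emb 3 1 (br c a'))
     (\<lambda>a. double_jacobiator br a b c)" (is ?first)
  "near_derivation 2
     (\<lambda>b b'. emb 1 2 (br a b) \<otimes>\<cdot> emb 2 3 (br b' c) \<oplus> emb 2 3 (br b c) \<otimes>\<cdot> emb 1 2 (br a b'))
     (\<lambda>b. double_jacobiator br a b c)" (is ?second)
  "near_derivation 3
     (\<lambda>c c'. emb 2 3 (br b c) \<otimes>\<cdot> emb 3 1 (br c' a) \<oplus> emb 3 1 (br c a) \<otimes>\<cdot> emb 2 3 (br b c'))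
     (\<lambda>c. double_jacobiator br a b c)" (is ?third)
proof -
  note outer = near_derivation_outer[OF br_in_tensors]
  note tau = near_derivation_tau[OF bij_cycle]
  note simps = double_jacobiator_def tau_cycle tau_tzero[OF bij_cycle]
  note sum = near_derivation_tplus[OF near_derivation_tplus]
  show ?first
    using sum[OF outer[of b c]
        tau[OF near_derivation_inner_right[of b c], of "[1, 2, 3]", unfolded cycle_123]
        tau[OF near_derivation_inner_left[of c b], of "[1, 3, 2]", unfolded cycle_132]]
    by (simp add: simps del: cycle_of_list.simps)
  show ?second
    using sum[OF near_derivation_inner_left[of a c]
        tau[OF outer[of c a], of "[1, 2, 3]", unfolded cycle_123]
        tau[OF near_derivation_inner_right[of c a], of "[1, 3, 2]", unfolded cycle_132]]
    by (simp add: simps del: cycle_of_list.simps)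
  show ?third
    using sum[OF near_derivation_inner_right[of a b]
        tau[OF near_derivation_inner_left[of b a], of "[1, 2, 3]", unfolded cycle_123]
        tau[OF outer[of a b], of "[1, 3, 2]", unfolded cycle_132]]
    by (simp add: simps del: cycle_of_list.simps)
qed

section \<open>The weak Jacobiator\<close>

text \<open>
  The first two entries trade places in the subtracted term, so the defect in the first entry is
  compared with the one in the second, whereas the third entry is compared with itself.
\<close>
lemma derivation_weak_jacobiator:
  "derivation (\<lambda>x X. slot 1 x \<otimes>\<cdot> X) (\<lambda>X x. X \<otimes>\<cdot> slot 1 x)
     (\<lambda>a. weak_jacobiator12 br a b c)" (is ?first)
  "derivation (\<lambda>x X. slot 2 x \<otimes>\<cdot> X) (\<lambda>X x. X \<otimes>\<cdot> slot 2 x)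
     (\<lambda>b. weak_jacobiator12 br a b c)" (is ?second)
  "derivation (\<lambda>x X. slot 3 x \<otimes>\<cdot> X) (\<lambda>X x. X \<otimes>\<cdot> slot 3 x)
     (\<lambda>c. weak_jacobiator12 br a b c)" (is ?third)
proof -
  (* Rewriting with these rules leaves one orientation of each pair of positions; each product
     acquires two signs, which cancel. *)
  have skew: "emb 1 (3 :: 3) (br x y) = tneg (emb 3 1 (br y x))"
    "emb (2 :: 3) 1 (br x y) = tneg (emb 1 2 (br y x))"
    "emb (3 :: 3) 2 (br x y) = tneg (emb 2 3 (br y x))" for x y
    by (rule emb_br_skew; simp)+
  show ?first unfolding weak_jacobiator12_def
    by (rule derivation_tminus[OF near_derivation_jacobiator(1)
          near_derivation_tau[OF bij_cycle near_derivation_jacobiator(2), of "[1, 2]",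
            unfolded cycle_12]])
      (simp add: tau_cycle skew tplus_ac del: cycle_of_list.simps)
  show ?second unfolding weak_jacobiator12_def
    by (rule derivation_tminus[OF near_derivation_jacobiator(2)
          near_derivation_tau[OF bij_cycle near_derivation_jacobiator(1), of "[1, 2]",
            unfolded cycle_12]])
      (simp add: tau_cycle skew tplus_ac del: cycle_of_list.simps)
  show ?third unfolding weak_jacobiator12_def
    by (rule derivation_tminus[OF near_derivation_jacobiator(3)
          near_derivation_tau[OF bij_cycle near_derivation_jacobiator(3), of "[1, 2]",
            unfolded cycle_12]])
      (simp add: tau_cycle skew tplus_ac del: cycle_of_list.simps)
qed

end

theorem lemma3p12:
  fixes scale :: "'k::field_char_0 \<Rightarrow> 'a::{ring,monoid_mult} \<Rightarrow> 'a"
    and br :: "'a \<Rightarrow> 'a \<Rightarrow> (2, 'a, 'k) tensor"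
  assumes "k_algebra scale"
    and "k_algebra.finitely_generated scale"
    and "k_algebra.right_double_bracket scale br"
  shows
    "(\<exists>l r. k_algebra.tensor_bimodule scale l r \<and>
        (\<forall>b c. k_algebra.derivation scale l r
                 (\<lambda>a. k_algebra.weak_jacobiator12 scale br a b c))) \<and>
     (\<exists>l r. k_algebra.tensor_bimodule scale l r \<and>
        (\<forall>a c. k_algebra.derivation scale l r
                 (\<lambda>b. k_algebra.weak_jacobiator12 scale br a b c))) \<and>
     (\<exists>l r. l = (\<lambda>c X. k_algebra.tmult scale (k_algebra.pure scale (tup3 1 1 c)) X) \<and>
        r = (\<lambda>X c. k_algebra.tmult scale X (k_algebra.pure scale (tup3 1 1 c))) \<and>
        k_algebra.tensor_bimodule scale l r \<and>
        (\<forall>a b. k_algebra.derivation scale l r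
                 (\<lambda>c. k_algebra.weak_jacobiator12 scale br a b c))) \<and>
     (\<forall>a b c\<^sub>1 c\<^sub>2. k_algebra.weak_jacobiator12 scale br a b (c\<^sub>1 * c\<^sub>2) =
        k_algebra.tplus scale
          (k_algebra.tmult scale (k_algebra.pure scale (tup3 1 1 c\<^sub>1))
             (k_algebra.weak_jacobiator12 scale br a b c\<^sub>2))
          (k_algebra.tmult scale (k_algebra.weak_jacobiator12 scale br a b c\<^sub>1)
             (k_algebra.pure scale (tup3 1 1 c\<^sub>2))))"
proof -
  interpret right_double_bracket_algebra scale br
    using assms(1,3) by (intro right_double_bracket_algebra.intro right_double_bracket_algebra_axioms.intro)
  have "(\<lambda>_. 1)(3 := c) = tup3 1 1 c" for c :: 'a
    using exhaust_3 by (auto simp: tup3_def fun_eq_iff)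
  then have tup3: "pure (tup3 1 1 c) = slot 3 c" for c
    by (simp add: slot_def)
  have leibniz: "weak_jacobiator12 br a b (c * c') =
    slot 3 c \<otimes>\<cdot> weak_jacobiator12 br a b c' \<oplus> weak_jacobiator12 br a b c \<otimes>\<cdot> slot 3 c'" for a b c c'
    using derivation_weak_jacobiator(3)[of a b] by (simp add: derivation_def)
  show ?thesis
    unfolding tup3
    by (intro conjI exI allI;
        (rule refl tensor_bimodule_slot derivation_weak_jacobiator leibniz))
qed

end
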